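(* Let $P$ be a finitely additive prevision, let $\mathcal{D}$ be a set of random variables on $\Omega$, and let $\pi=\{H_j\}_{j=1}^\infty$ be a denumerable partition of $\Omega$ into nonempty events such that $P$ satisfies the law of total previsions in $\pi$ with respect to $\mathcal{D}$. Let $X\in\mathcal{D}$ be a random variable with finite prevision $p_X=P(X)$ and finite conditional prevision $p_j=P(X\mid H_j)$ given each $H_j$. Assume that, for every $j$, $P(\cdot\mid H_j)$ is a finitely additive expectation that satisfies $P(Z\mid H_j)=P(H_jZ\mid H_j)$ for all random variables $Z$ in its domain. Let $\mathcal{C}$ be a collection of strictly proper scoring rules of integral form (as defined in the context). (3.1) Let $\{\alpha_j\}_{j=0}^\infty$ be real numbers. The sum of losses $$\alpha_0(X(\omega)-p_X)+\sum_{j=1}^\infty\alpha_jH_j(\omega)[X(\omega)-p_j]$$ is not uniformly strictly dominated by abstaining; that is, there is no $\varepsilon>0$ such that this sum is greater than $\varepsilon$ for all $\omega\in\Omega$. (3.2) Let $g_0,g_1,g_2,\dots$ be elements of $\mathcal{C}$. There is no rival set of forecasts that uniformly strictly dominates the sum of scores $$g_0(X(\omega),p_X)+\sum_{j=1}^\infty H_j(\omega)g_j(X(\omega),p_j);$$ that is, there are no real numbers $q_X,q_1,q_2,\dots$ and $\varepsilon>0$ such that for all $\omega\in\Omega$ $$g_0(X(\omega),p_X)+\sum_{j=1}^\infty H_j(\omega)g_j(X(\omega),p_j)>g_0(X(\omega),q_X)+\sum_{j=1}^\infty H_j(\omega)g_j(X(\omega),q_j)+\varepsilon .$$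
   Context: $\Omega$ is a nonempty set; a random variable is an arbitrary function $\Omega\to\mathbb{R}$; events are identified with their indicator functions, so $H_j(\omega)=1$ if $\omega\in H_j$ and $0$ otherwise. Finitely additive expectation: let $\mathcal{L}$ be a linear space of real-valued functions on $\Omega$ containing all constants. A functional $L:\mathcal{L}\to[-\infty,\infty]$ is a finitely additive expectation if (a) $X\le Y$ implies $L(X)\le L(Y)$; (b) $L(\alpha X+\beta Y)=\alpha L(X)+\beta L(Y)$ for all real $\alpha,\beta$ and $X,Y\in\mathcal{L}$ whenever the right-hand side is well defined (not $\infty-\infty$; $0\times\pm\infty=0$); (c) $L(1)=1$. A finitely additive prevision $P$ is (the restriction to a collection of random variables of) a finitely additive expectation; here it is defined at least on $\mathcal{D}$ and on the random variables $P(X\mid\pi)$, $X\in\mathcal{D}$, below. Each $P(\cdot\mid H_j)$ is defined on a linear space of random variables that contains $\mathcal{D}$ and the constants and is closed under multiplication by $H_j$. Law of total previsions: for $X\in\mathcal{D}$ let $P(X\mid\pi)$ denote the random variable $Y$ with $Y(\omega)=P(X\mid H_j)$ for all $\omega\in H_j$ and all $j$. $P$ satisfies the law of total previsions in $\pi$ with respect to $\mathcal{D}$ if $P(X)=P[P(X\mid\pi)]$ for every $X\in\mathcal{D}$. Scoring rules of integral form: $g:\mathbb{R}\times\mathbb{R}\to[0,\infty)$ is of integral form if there is a measure $\lambda$ on $\mathbb{R}$, mutually absolutely continuous with Lebesgue measure and finite on every bounded interval, such that $$g(x,q)=\int_x^q (v-x)\,d\lambda(v)\ \text{ if } x\le q,\qquad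 g(x,q)=\int_q^x (x-v)\,d\lambda(v)\ \text{ if } x>q .$$ (Such rules are strictly proper, i.e. expected score is uniquely minimized by taking the forecast equal to the mean.) *)

theory Defs
  imports "HOL-Analysis.Analysis"
begin

text \<open>Random variables on \<open>\<Omega>\<close> are arbitrary functions \<open>'w \<Rightarrow> real\<close>, where the (nonempty)
  type \<open>'w\<close> plays the role of \<open>\<Omega>\<close>.\<close>

definition linear_space_with_constants :: "('w \<Rightarrow> real) set \<Rightarrow> bool" where
  "linear_space_with_constants \<L> \<longleftrightarrow>
     (\<forall>c. (\<lambda>_. c) \<in> \<L>) \<and>
     (\<forall>X\<in>\<L>. \<forall>Y\<in>\<L>. \<forall>\<alpha> \<beta>. (\<lambda>\<omega>. \<alpha> * X \<omega> + \<beta> * Y \<omega>) \<in> \<L>)"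

text \<open>In \<^typ>\<open>ereal\<close> one has \<open>0 * \<infinity> = 0\<close>, but also \<open>\<infinity> + (-\<infinity>) = \<infinity>\<close>; hence sums of opposite
  infinities have to be excluded explicitly in linearity.\<close>

definition finitely_additive_expectation ::
    "('w \<Rightarrow> real) set \<Rightarrow> (('w \<Rightarrow> real) \<Rightarrow> ereal) \<Rightarrow> bool" where
  "finitely_additive_expectation \<L> L \<longleftrightarrow>
     linear_space_with_constants \<L> \<and>
     (\<forall>X\<in>\<L>. \<forall>Y\<in>\<L>. X \<le> Y \<longrightarrow> L X \<le> L Y) \<and>
     (\<forall>X\<in>\<L>. \<forall>Y\<in>\<L>. \<forall>\<alpha> \<beta>.
        \<not> (ereal \<alpha> * L X = \<infinity> \<and> ereal \<beta> * L Y = -\<infinity>) \<longrightarrow>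
        \<not> (ereal \<alpha> * L X = -\<infinity> \<and> ereal \<beta> * L Y = \<infinity>) \<longrightarrow>
        L (\<lambda>\<omega>. \<alpha> * X \<omega> + \<beta> * Y \<omega>) = ereal \<alpha> * L X + ereal \<beta> * L Y) \<and>
     L (\<lambda>_. 1) = 1"

text \<open>A prevision is only given on a collection \<open>\<K>\<close> of random variables, which need not be a
  linear space; values of \<open>P\<close> outside \<open>\<K>\<close> are irrelevant.\<close>

definition finitely_additive_prevision ::
    "('w \<Rightarrow> real) set \<Rightarrow> (('w \<Rightarrow> real) \<Rightarrow> ereal) \<Rightarrow> bool" where
  "finitely_additive_prevision \<K> P \<longleftrightarrow>
     (\<exists>\<L> L. finitely_additive_expectation \<L> L \<and> \<K> \<subseteq> \<L> \<and> (\<forall>X\<in>\<K>. P X = L X))"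

text \<open>The cells are \<open>H 1, H 2, \<dots>\<close>; the value \<open>H 0\<close> is not used (index 0 is reserved for the
  unconditional forecast).\<close>

definition denumerable_partition :: "(nat \<Rightarrow> 'w set) \<Rightarrow> bool" where
  "denumerable_partition H \<longleftrightarrow>
     (\<forall>j\<ge>1. H j \<noteq> {}) \<and> disjoint_family_on H {1..} \<and> (\<Union>j\<in>{1..}. H j) = UNIV"

text \<open>\<open>is_prevision_given_partition H Pc X Y\<close> says that \<open>Y\<close> is the random variable
  \<open>P(X | \<pi>)\<close>, where \<open>Pc j\<close> stands for \<open>P(\<cdot> | H j)\<close>. Such a (real-valued) \<open>Y\<close> is unique, and it
  exists iff all the values \<open>P(X | H j)\<close> are finite.\<close>

definition is_prevision_given_partition ::
    "(nat \<Rightarrow> 'w set) \<Rightarrow> (nat \<Rightarrow> ('w \<Rightarrow> real) \<Rightarrow> ereal) \<Rightarrow> ('w \<Rightarrow> real) \<Rightarrow> ('w \<Rightarrow> real) \<Rightarrow> bool" where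
  "is_prevision_given_partition H Pc X Y \<longleftrightarrow> (\<forall>j\<ge>1. \<forall>\<omega>\<in>H j. ereal (Y \<omega>) = Pc j X)"

definition law_of_total_previsions ::
    "(('w \<Rightarrow> real) \<Rightarrow> ereal) \<Rightarrow> (nat \<Rightarrow> ('w \<Rightarrow> real) \<Rightarrow> ereal) \<Rightarrow> (nat \<Rightarrow> 'w set) \<Rightarrow>
     ('w \<Rightarrow> real) set \<Rightarrow> bool" where
  "law_of_total_previsions P Pc H \<D> \<longleftrightarrow>
     (\<forall>X\<in>\<D>. \<forall>Y. is_prevision_given_partition H Pc X Y \<longrightarrow> P X = P Y)"

text \<open>\<open>g x q\<close> is the score of the forecast \<open>q\<close> when \<open>x\<close> is observed. The measure has no atoms, so
  it is immaterial whether the endpoints belong to the interval of integration.\<close>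

definition integral_form :: "(real \<Rightarrow> real \<Rightarrow> real) \<Rightarrow> bool" where
  "integral_form g \<longleftrightarrow>
     (\<forall>x q. 0 \<le> g x q) \<and>
     (\<exists>\<mu>. sets \<mu> = sets borel \<and>
          absolutely_continuous lborel \<mu> \<and> absolutely_continuous \<mu> lborel \<and>
          (\<forall>a b. emeasure \<mu> {a..b} < \<infinity>) \<and>
          (\<forall>x q. x \<le> q \<longrightarrow> g x q = (LINT v:{x..q}|\<mu>. (v - x))) \<and>
          (\<forall>x q. q < x \<longrightarrow> g x q = (LINT v:{q..x}|\<mu>. (x - v))))"

text \<open>It suffices to consider the observation as the identity on \<open>real\<close>, since an expectation on an
  arbitrary space can be transported along the observed random variable. Strict inequality cannot be
  asked for when all expected scores are infinite. Every rule of integral form is strictly proper in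
  this sense.\<close>

definition strictly_proper :: "(real \<Rightarrow> real \<Rightarrow> real) \<Rightarrow> bool" where
  "strictly_proper g \<longleftrightarrow>
     (\<forall>\<L> L m q. finitely_additive_expectation \<L> L \<longrightarrow>
        (\<lambda>x. x) \<in> \<L> \<longrightarrow> L (\<lambda>x. x) = ereal m \<longrightarrow>
        (\<lambda>x. g x m) \<in> \<L> \<longrightarrow> (\<lambda>x. g x q) \<in> \<L> \<longrightarrow> q \<noteq> m \<longrightarrow>
        L (\<lambda>x. g x m) < L (\<lambda>x. g x q) \<or>
        L (\<lambda>x. g x m) = \<infinity> \<and> L (\<lambda>x. g x q) = \<infinity>)"

end

theory Submission
  imports Defs
begin

text \<open>For a rule \<open>g\<close> of integral form the difference \<open>g x p - g x q\<close> is an affine function of the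
  observation \<open>x\<close>: the two integrals share the part outside the interval between \<open>p\<close> and \<open>q\<close>, and
  on that interval what remains is an integral of \<open>x - v\<close>, with sign according to the order of \<open>p\<close>
  and \<open>q\<close>. At \<open>x = p\<close> the difference is \<open>- g p q \<le> 0\<close>, so it has the form \<open>a * (x - p) - g p q\<close>
  (\<open>integral_form_score_difference\<close>). The gain from replacing forecasts by rivals is therefore
  bounded by a linear loss with suitable stakes \<open>a\<close>, and a rival that dominates the scores turns
  into stakes whose losses are dominated by abstaining. The claim on scores thus follows from the one on losses.

  For the losses, suppose that \<open>\<alpha> 0 * (X - p\<^sub>X) + \<alpha> j * (X - p j) > \<epsilon>\<close> on every cell \<open>H j\<close>. The
  conditional prevision given \<open>H j\<close> looks only at \<open>H j\<close>, and it annihilates \<open>X - p j\<close>; what is left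
  is \<open>\<alpha> 0 * (p j - p\<^sub>X) \<ge> \<epsilon>\<close> (\<open>conditional_expectation_affine_ge\<close>). Hence
  \<open>\<alpha> 0 * (Y - p\<^sub>X) \<ge> \<epsilon>\<close> everywhere for \<open>Y = P(X | \<pi>)\<close>. The law of total previsions gives
  \<open>P(Y) = p\<^sub>X\<close>, so taking previsions yields \<open>0 \<ge> \<epsilon>\<close>. Each cell is treated separately, and the
  cells are recombined only through \<open>Y\<close>; here the law does what countable additivity would do for
  a probability measure.\<close>

section \<open>Finitely additive expectations of affine functions\<close>

lemma expectation_mono:
  assumes "finitely_additive_expectation \<L> E" "X \<in> \<L>" "Y \<in> \<L>" "\<And>\<omega>. X \<omega> \<le> Y \<omega>"
  shows "E X \<le> E Y"
  using assms unfolding finitely_additive_expectation_def le_fun_def by blast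

lemma expectation_linear:
  assumes "finitely_additive_expectation \<L> E" "X \<in> \<L>" "Y \<in> \<L>"
    and "E X = ereal x" "E Y = ereal y"
  shows "E (\<lambda>\<omega>. a * X \<omega> + b * Y \<omega>) = ereal (a * x + b * y)"
  using assms unfolding finitely_additive_expectation_def by simp

lemma space_closed:
  assumes "finitely_additive_expectation \<L> E" "X \<in> \<L>" "Y \<in> \<L>"
  shows "(\<lambda>\<omega>. a * X \<omega> + b * Y \<omega>) \<in> \<L>"
  using assms unfolding finitely_additive_expectation_def linear_space_with_constants_def by simp

lemma const_in_space:
  assumes "finitely_additive_expectation \<L> E"
  shows "(\<lambda>_. c) \<in> \<L>"
  using assms unfolding finitely_additive_expectation_def linear_space_with_constants_def by simp

lemma affine_in_space:
  assumes "finitely_additive_expectation \<L> E" "X \<in> \<L>"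
  shows "(\<lambda>\<omega>. a * X \<omega> + b) \<in> \<L>"
  using space_closed[OF assms const_in_space[OF assms(1), of 1], of a b] by simp

lemma expectation_affine:
  assumes "finitely_additive_expectation \<L> E" "X \<in> \<L>" "E X = ereal m"
  shows "E (\<lambda>\<omega>. a * X \<omega> + b) = ereal (a * m + b)"
proof -
  have one: "E (\<lambda>_. 1) = ereal 1"
    using assms(1) unfolding finitely_additive_expectation_def by (simp add: one_ereal_def)
  show ?thesis
    using expectation_linear[where Y = "\<lambda>_. 1" and a = a and b = b,
        OF assms(1,2) const_in_space[OF assms(1)] assms(3) one] by simp
qed

lemma expectation_const:
  assumes "finitely_additive_expectation \<L> E"
  shows "E (\<lambda>_. c) = ereal c"
proof -
  have one: "E (\<lambda>_. 1) = ereal 1"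
    using assms unfolding finitely_additive_expectation_def by (simp add: one_ereal_def)
  show ?thesis
    using expectation_affine[where X = "\<lambda>_. 1" and a = 0 and b = c,
        OF assms const_in_space[OF assms] one] by simp
qed

text \<open>An expectation that does not change under multiplication by the indicator of \<open>A\<close> sees only
  values on \<open>A\<close>, so a lower bound on \<open>A\<close> alone is a lower bound for the expectation.\<close>

lemma conditional_expectation_affine_ge:
  assumes E: "finitely_additive_expectation \<L> E"
    and closed: "\<And>Z. Z \<in> \<L> \<Longrightarrow> (\<lambda>\<omega>. indicator A \<omega> * Z \<omega>) \<in> \<L>"
    and cond: "\<And>Z. Z \<in> \<L> \<Longrightarrow> E Z = E (\<lambda>\<omega>. indicator A \<omega> * Z \<omega>)"
    and X: "X \<in> \<L>" "E X = ereal m"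
    and ge: "\<And>\<omega>. \<omega> \<in> A \<Longrightarrow> c \<le> a * X \<omega> + b"
  shows "c \<le> a * m + b"
proof -
  let ?W = "\<lambda>\<omega>. a * X \<omega> + b"
  note W = affine_in_space[OF E X(1), of a b] and C = const_in_space[OF E, of c]
  have "ereal c = E (\<lambda>\<omega>. indicator A \<omega> * c)"
    using cond[OF C] expectation_const[OF E, of c] by simp
  also have "\<dots> \<le> E (\<lambda>\<omega>. indicator A \<omega> * ?W \<omega>)"
    using ge by (intro expectation_mono[OF E closed[OF C] closed[OF W]])
      (simp split: split_indicator)
  also have "\<dots> = ereal (a * m + b)"
    using cond[OF W] expectation_affine[OF E X, of a b] by simp
  finally show ?thesis by simp
qed

section \<open>Random variables that are given cell by cell\<close>

lemma obtain_cell: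
  assumes "denumerable_partition H"
  obtains i where "\<omega> \<in> H (Suc i)"
proof -
  obtain j where j: "j \<ge> 1" "\<omega> \<in> H j"
    using assms unfolding denumerable_partition_def by blast
  then show thesis
    using that[of "j - 1"] by simp
qed

lemma partition_index_unique:
  assumes "denumerable_partition H" "1 \<le> i" "1 \<le> j" "\<omega> \<in> H i" "\<omega> \<in> H j"
  shows "i = j"
  using assms unfolding denumerable_partition_def disjoint_family_on_def by auto

lemma suminf_indicator_partition:
  fixes f :: "nat \<Rightarrow> real"
  assumes "denumerable_partition H" "\<omega> \<in> H (Suc i)"
  shows "(\<Sum>j. indicator (H (Suc j)) \<omega> * f j) = f i"
proof -
  have "indicator (H (Suc j)) \<omega> * f j = 0" if "j \<noteq> i" for j
    using partition_index_unique[OF assms(1), of "Suc j" "Suc i" \<omega>] assms(2) that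
    by (auto simp: indicator_def)
  then have "(\<Sum>j. indicator (H (Suc j)) \<omega> * f j) = (\<Sum>j\<in>{i}. indicator (H (Suc j)) \<omega> * f j)"
    by (intro suminf_finite) auto
  then show ?thesis
    using assms(2) by simp
qed

text \<open>This supplies \<open>P(X | \<pi>)\<close> as a random variable once the conditional previsions are finite.\<close>

lemma exists_cellwise_constant:
  fixes p :: "nat \<Rightarrow> real"
  assumes "denumerable_partition H"
  shows "\<exists>Y. \<forall>j\<ge>1. \<forall>\<omega>\<in>H j. Y \<omega> = p j"
proof (intro exI allI impI ballI)
  fix j \<omega> assume j: "1 \<le> j" "\<omega> \<in> H j"
  show "(\<lambda>\<omega>. p (THE j. 1 \<le> j \<and> \<omega> \<in> H j)) \<omega> = p j"
    using j partition_index_unique[OF assms] by (auto intro!: arg_cong[of _ _ p] the_equality)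
qed

section \<open>Stakes on a partition\<close>

text \<open>Conditioning on a cell removes the cell's own stake, which leaves the bound \<open>\<epsilon>\<close> for the stake
  \<open>\<alpha> 0\<close> on \<open>Y - m\<close> everywhere; this is impossible because \<open>Y - m\<close> has expectation \<open>0\<close>.\<close>

lemma stakes_not_uniformly_dominated:
  assumes part: "denumerable_partition H"
    and cells: "\<And>j. j \<ge> 1 \<Longrightarrow> finitely_additive_expectation (\<M> j) (Pc j)"
    and closed: "\<And>j Z. j \<ge> 1 \<Longrightarrow> Z \<in> \<M> j \<Longrightarrow> (\<lambda>\<omega>. indicator (H j) \<omega> * Z \<omega>) \<in> \<M> j"
    and cond: "\<And>j Z. j \<ge> 1 \<Longrightarrow> Z \<in> \<M> j \<Longrightarrow> Pc j Z = Pc j (\<lambda>\<omega>. indicator (H j) \<omega> * Z \<omega>)"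
    and X: "\<And>j. j \<ge> 1 \<Longrightarrow> X \<in> \<M> j" "\<And>j. j \<ge> 1 \<Longrightarrow> Pc j X = ereal (p j)"
    and L: "finitely_additive_expectation \<L> L"
    and Y: "Y \<in> \<L>" "L Y = ereal m" "\<And>j \<omega>. j \<ge> 1 \<Longrightarrow> \<omega> \<in> H j \<Longrightarrow> Y \<omega> = p j"
    and "\<epsilon> > 0"
  shows "\<exists>i. \<exists>\<omega>\<in>H (Suc i).
           \<alpha> 0 * (X \<omega> - m) + \<alpha> (Suc i) * (X \<omega> - p (Suc i)) \<le> (\<epsilon>::real)"
proof (rule ccontr)
  assume "\<not> ?thesis"
  then have gt: "\<epsilon> < \<alpha> 0 * (X \<omega> - m) + \<alpha> (Suc i) * (X \<omega> - p (Suc i))"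
    if "\<omega> \<in> H (Suc i)" for i \<omega>
    using that by (meson not_le)
  have cell: "\<epsilon> \<le> \<alpha> 0 * (p (Suc i) - m)" for i
  proof -
    have j: "Suc i \<ge> 1"
      by simp
    have "\<epsilon> \<le> (\<alpha> 0 + \<alpha> (Suc i)) * X \<omega> + (- \<alpha> 0 * m - \<alpha> (Suc i) * p (Suc i))"
      if "\<omega> \<in> H (Suc i)" for \<omega>
      using gt[OF that] by (simp add: algebra_simps)
    from conditional_expectation_affine_ge[OF cells[OF j] closed[OF j] cond[OF j]
        X(1)[OF j] X(2)[OF j] this]
    have "\<epsilon> \<le> (\<alpha> 0 + \<alpha> (Suc i)) * p (Suc i) + (- \<alpha> 0 * m - \<alpha> (Suc i) * p (Suc i))" .
    then show ?thesis
      by (simp add: algebra_simps)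
  qed
  have "\<epsilon> \<le> \<alpha> 0 * Y \<omega> + (- \<alpha> 0 * m)" for \<omega>
  proof -
    obtain i where "\<omega> \<in> H (Suc i)"
      using obtain_cell[OF part] .
    then show ?thesis
      using cell[of i] Y(3)[of "Suc i" \<omega>] by (simp add: algebra_simps)
  qed
  then have "L (\<lambda>_. \<epsilon>) \<le> L (\<lambda>\<omega>. \<alpha> 0 * Y \<omega> + (- \<alpha> 0 * m))"
    by (intro expectation_mono[OF L const_in_space[OF L] affine_in_space[OF L Y(1)]])
  then have "\<epsilon> \<le> 0"
    using expectation_const[OF L, of \<epsilon>] expectation_affine[OF L Y(1,2), of "\<alpha> 0" "- \<alpha> 0 * m"]
    by simp
  with \<open>\<epsilon> > 0\<close> show False
    by simp
qed

section \<open>Scores of integral form\<close>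

text \<open>On both sides of the case distinction the score is the integral of \<open>v - x\<close> weighted by the
  indicator of \<open>{x..q}\<close> minus the indicator of \<open>{q..x}\<close>: at \<open>x = q\<close> the integrand vanishes, and
  otherwise one of the intervals is empty. In the difference of the weights for \<open>p\<close> and \<open>q\<close> the
  observation \<open>x\<close> cancels almost everywhere, and only the signed indicator of the interval between
  \<open>q\<close> and \<open>p\<close> remains. Hence \<open>x\<close> enters the integrand only through the factor \<open>v - x\<close>. The slope
  \<open>a\<close> is minus the signed measure of that interval.\<close>

lemma integral_form_score_difference:
  assumes "integral_form g"
  shows "\<exists>a. \<forall>x. g x p - g x q = a * (x - p) - g p q"
proof -
  obtain \<mu> :: "real measure" where sets: "sets \<mu> = sets borel"
    and ac: "absolutely_continuous lborel \<mu>"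
    and fin: "\<And>a b. emeasure \<mu> {a..b} < \<infinity>"
    and le: "\<And>x q. x \<le> q \<Longrightarrow> g x q = (LINT v:{x..q}|\<mu>. (v - x))"
    and gt: "\<And>x q. q < x \<Longrightarrow> g x q = (LINT v:{q..x}|\<mu>. (x - v))"
    using assms unfolding integral_form_def by auto
  have meas: "f \<in> borel_measurable \<mu>"
    if "f \<in> borel_measurable borel" for f :: "real \<Rightarrow> real"
    using that by (subst measurable_cong_sets[OF sets refl])
  \<comment> \<open>Absolute continuity excludes atoms, so the endpoints of the intervals do not matter.\<close>
  have ne: "AE v in \<mu>. v \<noteq> c" for c :: real
  proof -
    have "{c} \<in> null_sets lborel"
      by (simp add: null_sets_def)
    then have "{c} \<in> null_sets \<mu>"
      using ac unfolding absolutely_continuous_def by blast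
    then show ?thesis
      by (rule AE_I'[of "{c}"]) auto
  qed
  have int: "integrable \<mu> (\<lambda>v. indicator {a..b} v * (v - c))" for a b c :: real
  proof (rule integrableI_bounded_set[where A = "{a..b}" and B = "\<bar>a\<bar> + \<bar>b\<bar> + \<bar>c\<bar>"])
    show "AE v in \<mu>. v \<in> {a..b} \<longrightarrow> norm (indicator {a..b} v * (v - c)) \<le> \<bar>a\<bar> + \<bar>b\<bar> + \<bar>c\<bar>"
      by (rule AE_I2) auto
    show "AE v in \<mu>. v \<notin> {a..b} \<longrightarrow> indicator {a..b} v * (v - c) = 0"
      by (rule AE_I2) auto
  qed (use fin in \<open>simp_all add: sets meas\<close>)
  define k where "k x q v = indicator {x..q} v * (v - x) - indicator {q..x} v * (v - x)"
    for x q v :: real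
  have k_int: "integrable \<mu> (k x q)" for x q
    unfolding k_def by (intro Bochner_Integration.integrable_diff int)
  have g_eq: "g x q = (\<integral>v. k x q v \<partial>\<mu>)" for x q
  proof (cases "x \<le> q")
    case True
    then show ?thesis
      unfolding le[OF True] set_lebesgue_integral_def k_def
      by (intro Bochner_Integration.integral_cong) (auto split: split_indicator)
  next
    case False
    then have "q < x" by simp
    then show ?thesis
      unfolding gt[OF \<open>q < x\<close>] set_lebesgue_integral_def k_def
      by (intro Bochner_Integration.integral_cong) (auto split: split_indicator)
  qed
  define D where "D v = (if q < v \<and> v \<le> p then 1 :: real else if p < v \<and> v \<le> q then -1 else 0)"
    for v
  have D_meas: "(\<lambda>v. D v * (v - x)) \<in> borel_measurable \<mu>" for x
    unfolding D_def by (rule meas) measurable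
  have D_int: "integrable \<mu> D"
  proof (rule integrableI_bounded_set[where A = "{min p q..max p q}" and B = 1])
    show "D \<in> borel_measurable \<mu>"
      unfolding D_def by (rule meas) measurable
  qed (use fin in \<open>auto simp: D_def sets\<close>)
  have diff: "k x p v - k x q v = D v * (v - x)" if "v \<noteq> p" "v \<noteq> q" "v \<noteq> x" for x v
    using that unfolding k_def D_def by (auto split: split_indicator)
  have diff_AE: "AE v in \<mu>. k x p v - k x q v = D v * (v - x)" for x
    using ne[of p] ne[of q] ne[of x] by eventually_elim (rule diff)
  have g_diff: "g x p - g x q = (\<integral>v. D v * (v - x) \<partial>\<mu>)" for x
    unfolding g_eq Bochner_Integration.integral_diff[OF k_int k_int, symmetric]
    by (rule integral_cong_AE[OF _ _ diff_AE])
       (simp_all add: D_meas borel_measurable_integrable k_int)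
  have Dp_int: "integrable \<mu> (\<lambda>v. D v * (v - p))"
    by (rule integrable_cong_AE_imp[OF Bochner_Integration.integrable_diff[OF k_int[of p p] k_int[of p q]]])
       (simp_all add: D_meas diff_AE)
  have "g x p - g x q = - (\<integral>v. D v \<partial>\<mu>) * (x - p) + (g p p - g p q)" for x
  proof -
    have "g x p - g x q = (\<integral>v. D v * (v - p) - (x - p) * D v \<partial>\<mu>)"
      unfolding g_diff by (simp add: algebra_simps)
    also have "\<dots> = (g p p - g p q) - (x - p) * (\<integral>v. D v \<partial>\<mu>)"
      unfolding g_diff using Dp_int D_int by simp
    finally show ?thesis by simp
  qed
  moreover have "g p p = 0"
    unfolding g_eq k_def by simp
  ultimately show ?thesis
    by (intro exI[of _ "- (\<integral>v. D v \<partial>\<mu>)"]) simp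
qed

section \<open>Coherence of previsions and forecasts\<close>

theorem theorem3:
  fixes P :: "('w \<Rightarrow> real) \<Rightarrow> ereal"
    and Pc :: "nat \<Rightarrow> ('w \<Rightarrow> real) \<Rightarrow> ereal"
    and \<K> \<D> :: "('w \<Rightarrow> real) set"
    and \<M> :: "nat \<Rightarrow> ('w \<Rightarrow> real) set"
    and H :: "nat \<Rightarrow> 'w set"
    and X :: "'w \<Rightarrow> real"
    and p\<^sub>X :: real
    and p :: "nat \<Rightarrow> real"
    and \<C> :: "(real \<Rightarrow> real \<Rightarrow> real) set"
  assumes "denumerable_partition H"
    and "finitely_additive_prevision \<K> P"
    and "\<D> \<subseteq> \<K>"
    and "\<And>Z Y. Z \<in> \<D> \<Longrightarrow> is_prevision_given_partition H Pc Z Y \<Longrightarrow> Y \<in> \<K>"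
    and "\<And>j. j \<ge> 1 \<Longrightarrow> finitely_additive_expectation (\<M> j) (Pc j)"
    and "\<And>j. j \<ge> 1 \<Longrightarrow> \<D> \<subseteq> \<M> j"
    and "\<And>j Z. j \<ge> 1 \<Longrightarrow> Z \<in> \<M> j \<Longrightarrow> (\<lambda>\<omega>. indicator (H j) \<omega> * Z \<omega>) \<in> \<M> j"
    and "\<And>j Z. j \<ge> 1 \<Longrightarrow> Z \<in> \<M> j \<Longrightarrow> Pc j Z = Pc j (\<lambda>\<omega>. indicator (H j) \<omega> * Z \<omega>)"
    and "law_of_total_previsions P Pc H \<D>"
    and "X \<in> \<D>"
    and "P X = ereal p\<^sub>X"
    and "\<And>j. j \<ge> 1 \<Longrightarrow> Pc j X = ereal (p j)"
    and "\<And>g. g \<in> \<C> \<Longrightarrow> strictly_proper g \<and> integral_form g"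
  shows "(\<forall>\<alpha> :: nat \<Rightarrow> real.
            \<not> (\<exists>\<epsilon>>0. \<forall>\<omega>.
                 \<alpha> 0 * (X \<omega> - p\<^sub>X)
                   + (\<Sum>j. \<alpha> (Suc j) * indicator (H (Suc j)) \<omega> * (X \<omega> - p (Suc j))) > \<epsilon>))
       \<and> (\<forall>g :: nat \<Rightarrow> real \<Rightarrow> real \<Rightarrow> real. (\<forall>j. g j \<in> \<C>) \<longrightarrow>
            \<not> (\<exists>(q\<^sub>X :: real) (q :: nat \<Rightarrow> real). \<exists>\<epsilon>>0. \<forall>\<omega>.
                 g 0 (X \<omega>) p\<^sub>X
                   + (\<Sum>j. indicator (H (Suc j)) \<omega> * g (Suc j) (X \<omega>) (p (Suc j)))
                 > g 0 (X \<omega>) q\<^sub>X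
                   + (\<Sum>j. indicator (H (Suc j)) \<omega> * g (Suc j) (X \<omega>) (q (Suc j))) + \<epsilon>))"
proof -
  note part = assms(1) and cells = assms(5) and closed = assms(7) and cond = assms(8)
    and g_form = assms(13)
  obtain \<L> L where L: "finitely_additive_expectation \<L> L"
    and \<K>: "\<K> \<subseteq> \<L>" "\<And>Z. Z \<in> \<K> \<Longrightarrow> P Z = L Z"
    using assms(2) unfolding finitely_additive_prevision_def by blast
  obtain Y where Y: "\<And>j \<omega>. j \<ge> 1 \<Longrightarrow> \<omega> \<in> H j \<Longrightarrow> Y \<omega> = p j"
    using exists_cellwise_constant[OF part, of p] by blast
  then have Y_prev: "is_prevision_given_partition H Pc X Y"
    unfolding is_prevision_given_partition_def using assms(12) by simp
  then have Y_\<K>: "Y \<in> \<K>"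
    using assms(4,10) by blast
  have "P X = P Y"
    using assms(9,10) Y_prev unfolding law_of_total_previsions_def by blast
  then have LY: "L Y = ereal p\<^sub>X"
    using assms(11) \<K>(2)[OF Y_\<K>] by simp
  have X: "X \<in> \<M> j" if "j \<ge> 1" for j
    using assms(6,10) that by blast
  have coherent: "\<exists>i. \<exists>\<omega>\<in>H (Suc i).
      \<alpha> 0 * (X \<omega> - p\<^sub>X) + \<alpha> (Suc i) * (X \<omega> - p (Suc i)) \<le> \<epsilon>"
    if "\<epsilon> > 0" for \<alpha> :: "nat \<Rightarrow> real" and \<epsilon> :: real
    by (rule stakes_not_uniformly_dominated[OF part cells closed cond X assms(12) L _ LY Y that])
       (use \<K>(1) Y_\<K> in auto)
  have losses: "\<not> (\<exists>\<epsilon>>0. \<forall>\<omega>.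
      \<alpha> 0 * (X \<omega> - p\<^sub>X)
        + (\<Sum>j. \<alpha> (Suc j) * indicator (H (Suc j)) \<omega> * (X \<omega> - p (Suc j))) > \<epsilon>)"
    for \<alpha> :: "nat \<Rightarrow> real"
  proof (intro notI, elim exE conjE)
    fix \<epsilon> :: real
    assume "\<epsilon> > 0" and dom: "\<forall>\<omega>. \<alpha> 0 * (X \<omega> - p\<^sub>X)
        + (\<Sum>j. \<alpha> (Suc j) * indicator (H (Suc j)) \<omega> * (X \<omega> - p (Suc j))) > \<epsilon>"
    then obtain i \<omega> where i: "\<omega> \<in> H (Suc i)"
      and small: "\<alpha> 0 * (X \<omega> - p\<^sub>X) + \<alpha> (Suc i) * (X \<omega> - p (Suc i)) \<le> \<epsilon>"
      using coherent by blast
    have "(\<Sum>j. \<alpha> (Suc j) * indicator (H (Suc j)) \<omega> * (X \<omega> - p (Suc j)))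
        = \<alpha> (Suc i) * (X \<omega> - p (Suc i))"
      using suminf_indicator_partition[OF part i, of "\<lambda>j. \<alpha> (Suc j) * (X \<omega> - p (Suc j))"]
      by (simp add: mult_ac)
    with small show False
      using dom[rule_format, of \<omega>] by simp
  qed
  have scores: "\<not> (\<exists>(q\<^sub>X :: real) (q :: nat \<Rightarrow> real). \<exists>\<epsilon>>0. \<forall>\<omega>.
      g 0 (X \<omega>) p\<^sub>X + (\<Sum>j. indicator (H (Suc j)) \<omega> * g (Suc j) (X \<omega>) (p (Suc j)))
      > g 0 (X \<omega>) q\<^sub>X + (\<Sum>j. indicator (H (Suc j)) \<omega> * g (Suc j) (X \<omega>) (q (Suc j))) + \<epsilon>)"
    if g: "\<forall>j. g j \<in> \<C>" for g :: "nat \<Rightarrow> real \<Rightarrow> real \<Rightarrow> real"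
  proof (intro notI, elim exE conjE)
    fix q\<^sub>X :: real and q :: "nat \<Rightarrow> real" and \<epsilon> :: real
    assume "\<epsilon> > 0" and dom: "\<forall>\<omega>.
      g 0 (X \<omega>) p\<^sub>X + (\<Sum>j. indicator (H (Suc j)) \<omega> * g (Suc j) (X \<omega>) (p (Suc j)))
      > g 0 (X \<omega>) q\<^sub>X + (\<Sum>j. indicator (H (Suc j)) \<omega> * g (Suc j) (X \<omega>) (q (Suc j))) + \<epsilon>"
    \<comment> \<open>All forecasts in one family, with the unconditional one at index \<open>0\<close>.\<close>
    define p' where "p' = p(0 := p\<^sub>X)"
    define q' where "q' = q(0 := q\<^sub>X)"
    have form: "integral_form (g j)" for j
      using g g_form by blast
    have "\<forall>j. \<exists>a. \<forall>x. g j x (p' j) - g j x (q' j) = a * (x - p' j) - g j (p' j) (q' j)"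
      using integral_form_score_difference[OF form] by blast
    from choice[OF this] obtain a where a:
      "\<And>j x. g j x (p' j) - g j x (q' j) = a j * (x - p' j) - g j (p' j) (q' j)"
      by blast
    have gain: "g j x (p' j) - g j x (q' j) \<le> a j * (x - p' j)" for j x
      using a[of j x] form[of j] unfolding integral_form_def by simp
    obtain i \<omega> where i: "\<omega> \<in> H (Suc i)"
      and small: "a 0 * (X \<omega> - p\<^sub>X) + a (Suc i) * (X \<omega> - p (Suc i)) \<le> \<epsilon>"
      using coherent[OF \<open>\<epsilon> > 0\<close>] by blast
    have "g 0 (X \<omega>) p\<^sub>X + g (Suc i) (X \<omega>) (p (Suc i))
        > g 0 (X \<omega>) q\<^sub>X + g (Suc i) (X \<omega>) (q (Suc i)) + \<epsilon>"
      using dom[rule_format, of \<omega>]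
      unfolding suminf_indicator_partition[OF part i] .
    with small show False
      using gain[of 0 "X \<omega>"] gain[of "Suc i" "X \<omega>"] unfolding p'_def q'_def by simp
  qed
  show ?thesis
    using losses scores by blast
qed

end
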